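(* Assume (A0), (A1) and (A2), let $(v^k)$ and $(\varphi^k)$, $\varphi^k=(\psi^k,\delta^k)$, be the sequences generated by the iterative algorithm, and suppose $v^k\to v^*\in\mathbb R^G$. Let $\psi^*$ be the indicator of $\{Lv^*+f\le Mv^*-v^*\}\cap G_{<0}$ and $\partial I^*=\{Lv^*+f=Mv^*-v^*\}\cap G_{<0}$. Then: (i) $\psi^k\to\psi^*$ in $(\partial I^* )^c$ and $Mv^k\to Mv^*$. (ii) If $\overline\psi,\overline\delta$ are any two limit points (limits of convergent subsequences) of $(\psi^k),(\delta^k)$ respectively, then $$\overline\delta\in\operatorname{argmax}_{\delta\in Z}\{B(\delta)v^*-c(\delta)\},\quad \overline\psi=0\text{ on }G_{\ge0},\quad\text{and}\quad\overline\psi\in\operatorname{argmax}_{i\in\{0,1\}}\{O_iv^*\}\text{ on }G_{<0},$$ with $O_0v=Lv+f$ and $O_1v=Mv-v$. (iii) If $v^*$ has the (discrete) unique impulse property, then $\delta^k\to\delta^*(v^* )$ and $Hv^k\to Hv^*$.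
   Context: Grid and operators. $G$ is a symmetric grid $x_{-N}=-x_N<\dots<x_{-1}=-x_1<x_0=0<x_1<\dots<x_N$ of real numbers; $\mathbb R^G$ is the set of functions $G\to\mathbb R$ (vectors), linear operators on $\mathbb R^G$ are identified with matrices in $\mathbb R^{G\times G}$, and orders, max, argmax are pointwise (elementwise). $S$ is the symmetry operator $Sv(x)=v(-x)$. $G_{<0}$, $G_{\ge0}$ are the sets of negative, resp. nonnegative, grid points; complements are taken in $G$. $f\in\mathbb R^G$ and $L:\mathbb R^G\to\mathbb R^G$ is linear. For each $x\in G$, $Z(x)\subseteq\mathbb R$ is a finite nonempty set, with $Z(x)=\{0\}$ if $x\ge0$; $Z=\prod_{x\in G}Z(x)$. For each $\delta\in Z$ there are given a linear $B(\delta):\mathbb R^G\to\mathbb R^G$, $c(\delta)\in(0,+\infty)^G$ and a vector $g(S\delta)\in\mathbb R^G$; these are row-decoupled: row $x$ of $B(\delta)$ and $c(\delta)$ depends only on $\delta(x)$, and entry $x$ of $g(S\delta)$ depends only on $(S\delta)(x)=\delta(-x)$. Define $Mv=\max_{\delta\in Z}\{B(\delta)v-c(\delta)\}$, $\delta^*(v)=\max(\operatorname{argmax}_{\delta\in Z}\{B(\delta)v-c(\delta)\})$ (pointwise largest maximizer), $H(\delta)v=SB(\delta)Sv+g(S\delta)$ and $Hv=H(\delta^*(v))v$. Strategies. $\Phi=\{\varphi=(I,\delta): I\subseteq G_{<0},\ \delta\in Z\}$; each $I\subseteq G_{<0}$ is identified with its indicator $\psi=\mathbf 1_I$. Algorithm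 (run indefinitely, with the single-player problems solved exactly). Choose $v^0\in\mathbb R^G$, set $I^0=\{Lv^0+f\le Mv^0-v^0\}\cap G_{<0}$ and $\delta^0=\delta^*(v^0)$. For $k=0,1,\dots$: let $v^{k+1/2}=H(\delta^k)v^k$ on $-I^k$ and $v^{k+1/2}=v^k$ on $(-I^k)^c$; with $D=(-I^k)^c$, let $v^{k+1}\in\mathbb R^G$ be the (unique) solution of $\max\{Lv+f,Mv-v\}=0$ on $D$ subject to $v=v^{k+1/2}$ on $D^c$; set $I^{k+1}=\{x\in D: (Lv^{k+1}+f)(x)\le\lambda(Mv^{k+1}-v^{k+1})(x)\}$ (intervention regions being understood as subsets of $G_{<0}$), where $\lambda>0$ is a fixed scaling factor, and $\delta^{k+1}=\delta^*(v^{k+1})$. $\varphi^k=(\psi^k,\delta^k)$ with $\psi^k=\mathbf 1_{I^k}$. Unique impulse property (UIP). $v\in\mathbb R^G$ has the UIP if for each $x\in\{Mv=v\}$ there is a unique impulse $\delta(x)\in Z(x)$ that realizes the maximum defining $Mv(x)$. Matrix notions. For a real square matrix $A$: row $i$ is WDD (resp. SDD) if $|A_{ii}|\ge\sum_{j\ne i}|A_{ij}|$ (resp. $>$); $A$ is WDD (SDD) if all rows are; $A$ is an $L_0$-matrix if its off-diagonal entries are $\le0$ and its diagonal entries are $\ge0$. graph$A$ is the directed graph on the row indices with an edge $(i,j)$ iff $A_{ij}\neq0$; a walk is a nonempty finite sequence of consecutive edges. Assumptions. (A0) For each $\varphi=(I,\delta)\in\Phi$ and $x\in I$ there is a walk in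 graph$B(\delta)$ from row $x$ to some row $y\in I^c$. (A1) $-L$ is an SDD $L_0$-matrix and, for each $\delta\in Z$, $\operatorname{Id}-B(\delta)$ is a WDD $L_0$-matrix. (A2) $B(\delta)$ has nonnegative diagonal elements for all $\delta\in Z$.
   Formalization: In (iii), false as stated when impulses tie where Mv*<v*, UIP gives δ^k→δ*(v* ) only on {Mv*=v*}∪G_{≥0} and Hv^k→Hv* only on the mirror image of that set; full convergence is claimed if the maximizing impulse of v* is unique at every grid point. *)

theory Defs
  imports "HOL-Analysis.Analysis"
begin

(* The grid is given by its position map p :: 'g => real, where the finite type 'g indexes the
   grid points. Vectors in R^G are elements of real^'g and linear operators on R^G are matrices in
   real^'g^'g. The range of p has 2N+1 elements, ordered as x_{-N} < ... < x_N. *)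

definition symmetric_grid :: "('g::finite \<Rightarrow> real) \<Rightarrow> bool" where
  "symmetric_grid p \<longleftrightarrow> inj p \<and> 0 \<in> range p \<and> (\<forall>x. - p x \<in> range p)"

definition mirror :: "('g::finite \<Rightarrow> real) \<Rightarrow> 'g \<Rightarrow> 'g" where
  "mirror p x = inv p (- p x)"

definition symm :: "('g::finite \<Rightarrow> real) \<Rightarrow> real^'g \<Rightarrow> real^'g" where
  "symm p v = (\<chi> x. v $ mirror p x)"

definition neg_points :: "('g::finite \<Rightarrow> real) \<Rightarrow> 'g set" where
  "neg_points p = {x. p x < 0}"

definition ind_vec :: "'g::finite set \<Rightarrow> real^'g" where
  "ind_vec A = (\<chi> x. indicator A x)"


definition WDD :: "real^'g^'g::finite \<Rightarrow> bool" where
  "WDD A \<longleftrightarrow> (\<forall>i. \<bar>A $ i $ i\<bar> \<ge> (\<Sum>j\<in>UNIV - {i}. \<bar>A $ i $ j\<bar>))"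

definition SDD :: "real^'g^'g::finite \<Rightarrow> bool" where
  "SDD A \<longleftrightarrow> (\<forall>i. \<bar>A $ i $ i\<bar> > (\<Sum>j\<in>UNIV - {i}. \<bar>A $ i $ j\<bar>))"

definition L0_matrix :: "real^'g^'g::finite \<Rightarrow> bool" where
  "L0_matrix A \<longleftrightarrow> (\<forall>i j. i \<noteq> j \<longrightarrow> A $ i $ j \<le> 0) \<and> (\<forall>i. A $ i $ i \<ge> 0)"

definition graph_edges :: "real^'g^'g::finite \<Rightarrow> ('g \<times> 'g) set" where
  "graph_edges A = {(i, j). A $ i $ j \<noteq> 0}"

definition has_walk :: "real^'g^'g::finite \<Rightarrow> 'g \<Rightarrow> 'g \<Rightarrow> bool" where
  "has_walk A x y \<longleftrightarrow> (x, y) \<in> (graph_edges A)\<^sup>+"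


definition impulses :: "('g::finite \<Rightarrow> real set) \<Rightarrow> (real^'g) set" where
  "impulses Zs = {\<delta>. \<forall>x. \<delta> $ x \<in> Zs x}"

definition strategies :: "('g::finite \<Rightarrow> real) \<Rightarrow> ('g \<Rightarrow> real set) \<Rightarrow> ('g set \<times> (real^'g)) set" where
  "strategies p Zs = {(I, \<delta>). I \<subseteq> neg_points p \<and> \<delta> \<in> impulses Zs}"

definition valid_impulse_sets :: "('g::finite \<Rightarrow> real) \<Rightarrow> ('g \<Rightarrow> real set) \<Rightarrow> bool" where
  "valid_impulse_sets p Zs \<longleftrightarrow>
     (\<forall>x. finite (Zs x) \<and> Zs x \<noteq> {}) \<and> (\<forall>x. p x \<ge> 0 \<longrightarrow> Zs x = {0})"

(* The vector g(S delta) is encoded as the value of g at symm p delta. *)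
definition row_decoupled ::
  "('g::finite \<Rightarrow> real) \<Rightarrow> ('g \<Rightarrow> real set) \<Rightarrow> (real^'g \<Rightarrow> real^'g^'g) \<Rightarrow> (real^'g \<Rightarrow> real^'g)
    \<Rightarrow> (real^'g \<Rightarrow> real^'g) \<Rightarrow> bool" where
  "row_decoupled p Zs B c g \<longleftrightarrow>
     (\<forall>\<delta>\<in>impulses Zs. \<forall>\<eta>\<in>impulses Zs. \<forall>x.
        (\<delta> $ x = \<eta> $ x \<longrightarrow> B \<delta> $ x = B \<eta> $ x \<and> c \<delta> $ x = c \<eta> $ x) \<and>
        (symm p \<delta> $ x = symm p \<eta> $ x \<longrightarrow> g (symm p \<delta>) $ x = g (symm p \<eta>) $ x))"

definition interv_op ::
  "('g::finite \<Rightarrow> real set) \<Rightarrow> (real^'g \<Rightarrow> real^'g^'g) \<Rightarrow> (real^'g \<Rightarrow> real^'g) \<Rightarrow> real^'g \<Rightarrow> real^'g" where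
  "interv_op Zs B c v = (\<chi> x. Max ((\<lambda>\<delta>. (B \<delta> *v v - c \<delta>) $ x) ` impulses Zs))"

definition argmax_impulses ::
  "('g::finite \<Rightarrow> real set) \<Rightarrow> (real^'g \<Rightarrow> real^'g^'g) \<Rightarrow> (real^'g \<Rightarrow> real^'g) \<Rightarrow> real^'g \<Rightarrow> (real^'g) set" where
  "argmax_impulses Zs B c v =
     {\<delta>. \<forall>x. is_arg_max (\<lambda>\<eta>. (B \<eta> *v v - c \<eta>) $ x) (\<lambda>\<eta>. \<eta> \<in> impulses Zs) \<delta>}"

definition opt_impulse ::
  "('g::finite \<Rightarrow> real set) \<Rightarrow> (real^'g \<Rightarrow> real^'g^'g) \<Rightarrow> (real^'g \<Rightarrow> real^'g) \<Rightarrow> real^'g \<Rightarrow> real^'g" where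
  "opt_impulse Zs B c v = (\<chi> x. Max ((\<lambda>\<delta>. \<delta> $ x) ` argmax_impulses Zs B c v))"

definition gain_op_at ::
  "('g::finite \<Rightarrow> real) \<Rightarrow> (real^'g \<Rightarrow> real^'g^'g) \<Rightarrow> (real^'g \<Rightarrow> real^'g) \<Rightarrow> real^'g \<Rightarrow> real^'g \<Rightarrow> real^'g" where
  "gain_op_at p B g \<delta> v = symm p (B \<delta> *v symm p v) + g (symm p \<delta>)"

definition gain_op ::
  "('g::finite \<Rightarrow> real) \<Rightarrow> ('g \<Rightarrow> real set) \<Rightarrow> (real^'g \<Rightarrow> real^'g^'g) \<Rightarrow> (real^'g \<Rightarrow> real^'g)
    \<Rightarrow> (real^'g \<Rightarrow> real^'g) \<Rightarrow> real^'g \<Rightarrow> real^'g" where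
  "gain_op p Zs B c g v = gain_op_at p B g (opt_impulse Zs B c v) v"

definition O_op ::
  "real^'g^'g \<Rightarrow> real^'g \<Rightarrow> ('g::finite \<Rightarrow> real set) \<Rightarrow> (real^'g \<Rightarrow> real^'g^'g) \<Rightarrow> (real^'g \<Rightarrow> real^'g)
    \<Rightarrow> real \<Rightarrow> real^'g \<Rightarrow> real^'g" where
  "O_op L f Zs B c i v = (if i = 0 then L *v v + f else interv_op Zs B c v - v)"


(* v (Suc k) is required to be a solution of the constrained problem; uniqueness is not presupposed.
   The sequence w holds the half steps v^{k+1/2}. *)
definition algorithm_run ::
  "('g::finite \<Rightarrow> real) \<Rightarrow> real^'g^'g \<Rightarrow> real^'g \<Rightarrow> ('g \<Rightarrow> real set) \<Rightarrow> (real^'g \<Rightarrow> real^'g^'g)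
    \<Rightarrow> (real^'g \<Rightarrow> real^'g) \<Rightarrow> (real^'g \<Rightarrow> real^'g) \<Rightarrow> real
    \<Rightarrow> (nat \<Rightarrow> real^'g) \<Rightarrow> (nat \<Rightarrow> real^'g) \<Rightarrow> (nat \<Rightarrow> 'g set) \<Rightarrow> (nat \<Rightarrow> real^'g) \<Rightarrow> bool" where
  "algorithm_run p L f Zs B c g lam v w I d \<longleftrightarrow>
     I 0 = {x. (L *v v 0 + f) $ x \<le> (interv_op Zs B c (v 0) - v 0) $ x} \<inter> neg_points p \<and>
     (\<forall>k. d k = opt_impulse Zs B c (v k)) \<and>
     (\<forall>k. let D = - (mirror p ` I k) in
        (\<forall>x. w k $ x = (if x \<in> D then v k $ x else gain_op_at p B g (d k) (v k) $ x)) \<and>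
        (\<forall>x\<in>D. max ((L *v v (Suc k) + f) $ x) ((interv_op Zs B c (v (Suc k)) - v (Suc k)) $ x) = 0) \<and>
        (\<forall>x\<in>- D. v (Suc k) $ x = w k $ x) \<and>
        I (Suc k) = {x \<in> D. (L *v v (Suc k) + f) $ x
                              \<le> lam * (interv_op Zs B c (v (Suc k)) - v (Suc k)) $ x} \<inter> neg_points p)"


definition unique_impulse_at ::
  "('g::finite \<Rightarrow> real set) \<Rightarrow> (real^'g \<Rightarrow> real^'g^'g) \<Rightarrow> (real^'g \<Rightarrow> real^'g) \<Rightarrow> real^'g \<Rightarrow> 'g \<Rightarrow> bool" where
  "unique_impulse_at Zs B c v x \<longleftrightarrow>
     (\<exists>!z. z \<in> Zs x \<and>
        (\<exists>\<delta>\<in>impulses Zs. \<delta> $ x = z \<and> (B \<delta> *v v - c \<delta>) $ x = interv_op Zs B c v $ x))"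

definition fixed_region ::
  "('g::finite \<Rightarrow> real set) \<Rightarrow> (real^'g \<Rightarrow> real^'g^'g) \<Rightarrow> (real^'g \<Rightarrow> real^'g) \<Rightarrow> real^'g \<Rightarrow> 'g set" where
  "fixed_region Zs B c v = {x. interv_op Zs B c v $ x = v $ x}"

(* This property says nothing about points of G_{<0} where Mv < v: maximizing impulses may be tied
   there, and then delta*(v^k) need not converge to delta*(v) at those points when v^k -> v. *)
definition UIP ::
  "('g::finite \<Rightarrow> real set) \<Rightarrow> (real^'g \<Rightarrow> real^'g^'g) \<Rightarrow> (real^'g \<Rightarrow> real^'g) \<Rightarrow> real^'g \<Rightarrow> bool" where
  "UIP Zs B c v \<longleftrightarrow> (\<forall>x\<in>fixed_region Zs B c v. unique_impulse_at Zs B c v x)"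

end

theory Submission
  imports Defs
begin

text \<open>
Everything the iteration decides at step \<open>k\<close> is a maximiser, over a finite set of choices, of
quantities depending continuously on \<open>v\<^sup>k\<close>. The impulse \<open>\<delta>\<^sup>k\<close> maximises
\<open>B(\<delta>)v\<^sup>k - c(\<delta>)\<close> in every row, by construction together with row-decoupling
(\<open>opt_impulse_in_argmax\<close>). At a negative grid point, \<open>\<psi>\<^sup>k\<close> is the largest maximiser of
\<open>i \<mapsto> O\<^sub>i v\<^sup>k\<close> over \<open>{0, 1}\<close>. For \<open>k = 0\<close> this is the definition; later on,
since the constrained problem is solved there with value \<open>0\<close>, one of
\<open>O\<^sub>0 v\<^sup>k\<close>, \<open>O\<^sub>1 v\<^sup>k\<close> vanishes and the other is nonpositive, and such a comparison is unaffected by the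
scaling \<open>\<lambda>\<close> (\<open>intervention_region_eq\<close>).

The argument then rests on one principle (\<open>eventually_arg_max_limit\<close>): among finitely many choices, a
choice that is strictly worse in the limit is strictly worse eventually, so that every maximiser is
eventually a maximiser of the limit problem. Hence limit points of the strategies are maximisers for
\<open>v\<^sup>*\<close>. Where the limit problem has just one maximiser, the strategies are eventually equal to it; for
\<open>\<psi>\<close> this happens at the negative points off \<open>\<partial>I\<^sup>*\<close> (at nonnegative points \<open>\<psi>\<^sup>k = 0\<close> throughout), for
\<open>\<delta>\<close> at the points with a unique impulse and at the nonnegative points, where \<open>0\<close> is the only impulse.
Row \<open>x\<close> of \<open>Hv\<close> involves only the impulse at \<open>-x\<close>, so it inherits convergence from there.
\<close>

section \<open>Finite maximisation under limits\<close>

text \<open>Finiteness lets the eventual strict inequalities between pairs of choices hold from one common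
step on. Ties of the limit problem may be broken either way before the limit, so only this inclusion
between the sets of maximisers can be expected.\<close>

lemma eventually_arg_max_limit:
  fixes u :: "'a \<Rightarrow> 'k \<Rightarrow> real"
  assumes fin: "finite A"
    and lim: "\<And>a. a \<in> A \<Longrightarrow> (u a \<longlongrightarrow> l a) F"
  shows "\<forall>\<^sub>F k in F. \<forall>a. is_arg_max (\<lambda>b. u b k) (\<lambda>b. b \<in> A) a \<longrightarrow> is_arg_max l (\<lambda>b. b \<in> A) a"
proof -
  have "\<forall>\<^sub>F k in F. l a < l b \<longrightarrow> u a k < u b k" if "a \<in> A" "b \<in> A" for a b
  proof (cases "l a < l b")
    case True
    then obtain m where m: "l a < m" "m < l b"
      using dense[of "l a" "l b"] by auto
    have "\<forall>\<^sub>F k in F. u a k < m" "\<forall>\<^sub>F k in F. m < u b k"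
      using order_tendstoD(2)[OF lim[OF that(1)] m(1)] order_tendstoD(1)[OF lim[OF that(2)] m(2)] .
    then show ?thesis
      by eventually_elim linarith
  qed simp
  then have "\<forall>\<^sub>F k in F. \<forall>a\<in>A. \<forall>b\<in>A. l a < l b \<longrightarrow> u a k < u b k"
    using fin by (simp add: eventually_ball_finite)
  then show ?thesis
    by eventually_elim (auto simp: is_arg_max_def)
qed

lemma tendsto_Max_image:
  fixes u :: "'a \<Rightarrow> 'k \<Rightarrow> real"
  assumes "finite A" "A \<noteq> {}" "\<And>a. a \<in> A \<Longrightarrow> (u a \<longlongrightarrow> l a) F"
  shows "((\<lambda>k. Max ((\<lambda>a. u a k) ` A)) \<longlongrightarrow> Max (l ` A)) F"
  using assms by (induction A rule: finite_ne_induct) (auto intro: tendsto_max)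

lemma ex_is_arg_max_finite:
  fixes u :: "'a \<Rightarrow> real"
  assumes "finite A" "A \<noteq> {}"
  shows "\<exists>a. is_arg_max u (\<lambda>b. b \<in> A) a"
proof -
  have "Max (u ` A) \<in> u ` A"
    using assms by simp
  then obtain a where "a \<in> A" "Max (u ` A) = u a"
    by blast
  moreover have "u b \<le> Max (u ` A)" if "b \<in> A" for b
    using assms that by simp
  ultimately show ?thesis
    by (auto simp: is_arg_max_linorder)
qed

text \<open>Choices are given by reals in the two lemmas below, because limit points of the indicators
\<open>\<psi>\<^sup>k\<close> are vectors of reals.\<close>

lemma of_bool_is_arg_max:
  fixes u :: "real \<Rightarrow> real"
  shows "is_arg_max u (\<lambda>i. i \<in> {0, 1}) (of_bool (u 0 \<le> u 1))"
  by (auto simp: is_arg_max_def)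

lemma is_arg_max_iff_of_bool:
  fixes u :: "real \<Rightarrow> real"
  assumes "u 0 \<noteq> u 1"
  shows "is_arg_max u (\<lambda>i. i \<in> {0, 1}) i \<longleftrightarrow> i = of_bool (u 0 \<le> u 1)"
  using assms by (auto simp: is_arg_max_def)

text \<open>A finite subset of a T1 space is discrete, so convergence inside it means being eventually constant. This is how
a limit point of strategies is itself one of the strategies used along the subsequence.\<close>

lemma eventually_eq_limit_in_finite:
  fixes y :: "nat \<Rightarrow> 'a::t1_space"
  assumes "finite A" "\<And>k. y k \<in> A" "y \<longlonglongrightarrow> l"
  shows "\<forall>\<^sub>F k in sequentially. y k = l"
proof -
  have "open (- (A - {l}))"
    using assms(1) by (intro open_Compl finite_imp_closed) simp
  then have "\<forall>\<^sub>F k in sequentially. y k \<in> - (A - {l})"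
    using assms(3) by (intro topological_tendstoD) auto
  then show ?thesis
    using assms(2) by (auto elim!: eventually_mono)
qed

lemma limit_point_satisfies:
  fixes y :: "nat \<Rightarrow> 'a::t1_space"
  assumes "finite A" "\<And>k. y k \<in> A"
    and "strict_mono r" "(y \<circ> r) \<longlonglongrightarrow> l"
    and "\<forall>\<^sub>F k in sequentially. P (y k)"
  shows "P l"
proof -
  have "\<forall>\<^sub>F k in sequentially. (y \<circ> r) k = l"
    using assms(1) _ assms(4) by (rule eventually_eq_limit_in_finite) (simp add: assms(2))
  moreover have "\<forall>\<^sub>F k in sequentially. P ((y \<circ> r) k)"
    using eventually_subseq[OF assms(3,5)] by simp
  ultimately have "\<forall>\<^sub>F k in sequentially. P l"
    by eventually_elim simp
  then show ?thesis
    by simp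
qed

section \<open>Mirror symmetry of the grid\<close>

lemma position_mirror:
  assumes "symmetric_grid p"
  shows "p (mirror p x) = - p x"
  using assms by (simp add: symmetric_grid_def mirror_def f_inv_into_f)

lemma mirror_mirror:
  assumes "symmetric_grid p"
  shows "mirror p (mirror p x) = x"
proof (rule injD)
  show "inj p"
    using assms by (simp add: symmetric_grid_def)
qed (simp add: position_mirror[OF assms])

section \<open>Optimal impulses\<close>

lemma finite_impulses:
  assumes "valid_impulse_sets p Zs"
  shows "finite (impulses Zs)"
proof (rule finite_subset)
  show "impulses Zs \<subseteq> vec_lambda ` (Pi\<^sub>E UNIV Zs)"
    by (auto simp: impulses_def PiE_def intro!: image_eqI[where x="vec_nth _"])
  show "finite (vec_lambda ` (Pi\<^sub>E UNIV Zs))"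
    using assms by (auto simp: valid_impulse_sets_def intro!: finite_imageI finite_PiE)
qed

lemma impulses_nonempty:
  assumes "valid_impulse_sets p Zs"
  shows "impulses Zs \<noteq> {}"
proof -
  have "(\<chi> x. SOME z. z \<in> Zs x) \<in> impulses Zs"
    using assms by (auto simp: impulses_def valid_impulse_sets_def some_in_eq)
  then show ?thesis
    by blast
qed

lemma net_gain_depends_on_row:
  assumes "row_decoupled p Zs B c g" "\<delta> \<in> impulses Zs" "\<eta> \<in> impulses Zs" "\<delta> $ x = \<eta> $ x"
  shows "(B \<delta> *v v - c \<delta>) $ x = (B \<eta> *v v - c \<eta>) $ x"
proof -
  have "B \<delta> $ x = B \<eta> $ x" "c \<delta> $ x = c \<eta> $ x"
    using assms unfolding row_decoupled_def by blast+
  then show ?thesis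
    by (simp add: matrix_vector_mul_component)
qed

text \<open>Because of row-decoupling, impulses that are optimal in single rows can be patched together to
one that is optimal in all rows at once: the set of maximisers is a product. This is why the pointwise
largest maximiser exists and is again a maximiser.\<close>

lemma argmax_impulses_patch:
  assumes dec: "row_decoupled p Zs B c g"
    and row: "\<And>x. is_arg_max (\<lambda>\<eta>. (B \<eta> *v v - c \<eta>) $ x) (\<lambda>\<eta>. \<eta> \<in> impulses Zs) (e x)"
  shows "(\<chi> x. e x $ x) \<in> argmax_impulses Zs B c v"
proof -
  have e: "e x \<in> impulses Zs" for x
    using row by (auto simp: is_arg_max_def)
  then have mem: "(\<chi> x. e x $ x) \<in> impulses Zs"
    by (simp add: impulses_def)
  have "(B (\<chi> x. e x $ x) *v v - c (\<chi> x. e x $ x)) $ x = (B (e x) *v v - c (e x)) $ x" for x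
    using dec mem e by (rule net_gain_depends_on_row) simp
  then show ?thesis
    using row mem by (simp add: argmax_impulses_def is_arg_max_def del: vector_minus_component)
qed

lemma argmax_impulses_subset: "argmax_impulses Zs B c v \<subseteq> impulses Zs"
  by (auto simp: argmax_impulses_def is_arg_max_def)

lemma argmax_impulses_nonempty:
  assumes "valid_impulse_sets p Zs" "row_decoupled p Zs B c g"
  shows "argmax_impulses Zs B c v \<noteq> {}"
proof -
  have "\<exists>\<delta>. is_arg_max (\<lambda>\<eta>. (B \<eta> *v v - c \<eta>) $ x) (\<lambda>\<eta>. \<eta> \<in> impulses Zs) \<delta>" for x
    using assms by (intro ex_is_arg_max_finite finite_impulses impulses_nonempty)
  then obtain e where
    "\<And>x. is_arg_max (\<lambda>\<eta>. (B \<eta> *v v - c \<eta>) $ x) (\<lambda>\<eta>. \<eta> \<in> impulses Zs) (e x)"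
    by metis
  from argmax_impulses_patch[OF assms(2) this] show ?thesis
    by blast
qed

lemma opt_impulse_in_argmax:
  assumes valid: "valid_impulse_sets p Zs" and dec: "row_decoupled p Zs B c g"
  shows "opt_impulse Zs B c v \<in> argmax_impulses Zs B c v"
proof -
  have "\<exists>\<delta>\<in>argmax_impulses Zs B c v. opt_impulse Zs B c v $ x = \<delta> $ x" for x
  proof -
    have "finite (argmax_impulses Zs B c v)"
      using argmax_impulses_subset finite_impulses[OF valid] by (rule finite_subset)
    then have "opt_impulse Zs B c v $ x \<in> (\<lambda>\<delta>. \<delta> $ x) ` argmax_impulses Zs B c v"
      using argmax_impulses_nonempty[OF valid dec] unfolding opt_impulse_def vec_lambda_beta
      by (intro Max_in) auto
    then show ?thesis
      by auto
  qed
  then obtain e where e: "\<And>x. e x \<in> argmax_impulses Zs B c v"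
      "\<And>x. opt_impulse Zs B c v $ x = e x $ x"
    by metis
  have "(\<chi> x. e x $ x) \<in> argmax_impulses Zs B c v"
    using e(1) by (intro argmax_impulses_patch[OF dec]) (simp add: argmax_impulses_def)
  moreover have "(\<chi> x. e x $ x) = opt_impulse Zs B c v"
    by (simp add: vec_eq_iff e(2))
  ultimately show ?thesis
    by simp
qed

lemma argmax_impulses_attain:
  assumes "valid_impulse_sets p Zs" "\<delta> \<in> argmax_impulses Zs B c v"
  shows "(B \<delta> *v v - c \<delta>) $ x = interv_op Zs B c v $ x"
  unfolding interv_op_def using assms finite_impulses[OF assms(1)]
  by (auto simp: argmax_impulses_def is_arg_max_linorder intro!: Max_eqI[symmetric])

text \<open>A unique impulse is a statement about single components, so it does not make the maximising vector
unique; it makes all maximisers agree at that point. At nonnegative points they agree because \<open>0\<close> is the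
only choice.\<close>

lemma argmax_impulses_agree:
  assumes valid: "valid_impulse_sets p Zs"
    and single: "unique_impulse_at Zs B c v x \<or> Zs x = {0}"
    and \<delta>: "\<delta> \<in> argmax_impulses Zs B c v" and \<eta>: "\<eta> \<in> argmax_impulses Zs B c v"
  shows "\<delta> $ x = \<eta> $ x"
proof -
  have imp: "\<delta> \<in> impulses Zs" "\<eta> \<in> impulses Zs"
    using \<delta> \<eta> argmax_impulses_subset by blast+
  then have Zs: "\<delta> $ x \<in> Zs x" "\<eta> $ x \<in> Zs x"
    by (simp_all add: impulses_def)
  from single show ?thesis
  proof
    let ?P = "\<lambda>z. z \<in> Zs x \<and>
      (\<exists>\<delta>\<in>impulses Zs. \<delta> $ x = z \<and> (B \<delta> *v v - c \<delta>) $ x = interv_op Zs B c v $ x)"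
    assume "unique_impulse_at Zs B c v x"
    then obtain z where z: "\<forall>y. ?P y \<longrightarrow> y = z"
      unfolding unique_impulse_at_def by (rule ex1E)
    have "?P (\<delta> $ x)" "?P (\<eta> $ x)"
      using Zs imp argmax_impulses_attain[OF valid] \<delta> \<eta> by blast+
    then show ?thesis
      using z[rule_format, of "\<delta> $ x"] z[rule_format, of "\<eta> $ x"] by (simp only:)
  next
    assume "Zs x = {0}"
    with Zs show ?thesis
      by simp
  qed
qed

section \<open>Continuity in the value vector\<close>

lemma tendsto_matrix_vector_mult:
  fixes A :: "real^'g^'g::finite"
  assumes "(v \<longlongrightarrow> l) F"
  shows "((\<lambda>k. A *v v k) \<longlongrightarrow> A *v l) F"
  using bounded_linear.tendsto[OF matrix_vector_mul_bounded_linear assms] .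

lemma tendsto_net_gain:
  fixes A :: "real^'g^'g::finite"
  assumes "(v \<longlongrightarrow> l) F"
  shows "((\<lambda>k. (A *v v k - b) $ x) \<longlongrightarrow> (A *v l - b) $ x) F"
  by (intro tendsto_intros tendsto_matrix_vector_mult assms)

lemma tendsto_interv_op:
  assumes "valid_impulse_sets p Zs" "(v \<longlongrightarrow> l) F"
  shows "((\<lambda>k. interv_op Zs B c (v k)) \<longlongrightarrow> interv_op Zs B c l) F"
proof (rule vec_tendstoI)
  fix x
  show "((\<lambda>k. interv_op Zs B c (v k) $ x) \<longlongrightarrow> interv_op Zs B c l $ x) F"
    unfolding interv_op_def vec_lambda_beta
    using assms by (intro tendsto_Max_image tendsto_net_gain finite_impulses impulses_nonempty)
qed

lemma tendsto_gain_op_at: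
  assumes "(v \<longlongrightarrow> l) F"
  shows "((\<lambda>k. gain_op_at p B g \<delta> (v k)) \<longlongrightarrow> gain_op_at p B g \<delta> l) F"
proof -
  have "((\<lambda>k. symm p (v k)) \<longlongrightarrow> symm p l) F"
    unfolding symm_def by (intro tendsto_vec_lambda tendsto_vec_nth assms)
  then have "((\<lambda>k. B \<delta> *v symm p (v k)) \<longlongrightarrow> B \<delta> *v symm p l) F"
    by (rule tendsto_matrix_vector_mult)
  then show ?thesis
    unfolding gain_op_at_def symm_def[of p "B _ *v _"]
    by (intro tendsto_add tendsto_vec_lambda tendsto_vec_nth tendsto_const)
qed

lemma tendsto_O_op:
  assumes "valid_impulse_sets p Zs" "(v \<longlongrightarrow> l) F"
  shows "((\<lambda>k. O_op L f Zs B c i (v k)) \<longlongrightarrow> O_op L f Zs B c i l) F"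
  using assms unfolding O_op_def
  by (cases "i = 0") (auto intro!: tendsto_intros tendsto_matrix_vector_mult tendsto_interv_op)

lemma eventually_argmax_impulses_subset:
  assumes valid: "valid_impulse_sets p Zs" and lim: "(v \<longlongrightarrow> l) F"
  shows "\<forall>\<^sub>F k in F. argmax_impulses Zs B c (v k) \<subseteq> argmax_impulses Zs B c l"
proof -
  have "\<forall>\<^sub>F k in F. \<forall>x. \<forall>\<delta>. is_arg_max (\<lambda>\<eta>. (B \<eta> *v v k - c \<eta>) $ x) (\<lambda>\<eta>. \<eta> \<in> impulses Zs) \<delta>
      \<longrightarrow> is_arg_max (\<lambda>\<eta>. (B \<eta> *v l - c \<eta>) $ x) (\<lambda>\<eta>. \<eta> \<in> impulses Zs) \<delta>"
    using lim
    by (intro eventually_all_finite eventually_arg_max_limit finite_impulses[OF valid] tendsto_net_gain)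
  then show ?thesis
    by eventually_elim (auto simp: argmax_impulses_def)
qed

lemma gain_op_at_depends_on_mirror:
  assumes dec: "row_decoupled p Zs B c g" and "\<delta> \<in> impulses Zs" "\<eta> \<in> impulses Zs"
    and "\<delta> $ mirror p x = \<eta> $ mirror p x"
  shows "gain_op_at p B g \<delta> v $ x = gain_op_at p B g \<eta> v $ x"
proof -
  have "symm p \<delta> $ x = symm p \<eta> $ x"
    using assms(4) by (simp add: symm_def)
  then have "g (symm p \<delta>) $ x = g (symm p \<eta>) $ x" "B \<delta> $ mirror p x = B \<eta> $ mirror p x"
    using assms unfolding row_decoupled_def by blast+
  then show ?thesis
    by (simp add: gain_op_at_def symm_def matrix_vector_mul_component)
qed

section \<open>Intervention regions of the algorithm\<close>

lemma intervention_region_subset: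
  assumes "algorithm_run p L f Zs B c g lam v w I d"
  shows "I k \<subseteq> neg_points p"
proof (cases k)
  case 0
  then show ?thesis
    using assms by (auto simp: algorithm_run_def)
next
  case (Suc n)
  then show ?thesis
    using assms by (auto simp: algorithm_run_def Let_def)
qed

text \<open>The scaling factor and the restriction to the previous domain are invisible: the opponent
intervenes at positive points only, so the constrained problem is solved at every negative point, and
when the larger of \<open>O\<^sub>0 v\<close> and \<open>O\<^sub>1 v\<close> is \<open>0\<close>, both comparisons say that \<open>O\<^sub>1 v = 0\<close>.\<close>

lemma intervention_region_eq:
  assumes grid: "symmetric_grid p" and lam: "0 < lam"
    and run: "algorithm_run p L f Zs B c g lam v w I d"
  shows "I k = {x. O_op L f Zs B c 0 (v k) $ x \<le> O_op L f Zs B c 1 (v k) $ x} \<inter> neg_points p"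
proof (cases k)
  case 0
  then show ?thesis
    using run by (simp add: algorithm_run_def O_op_def)
next
  case (Suc n)
  let ?a = "\<lambda>x. O_op L f Zs B c 0 (v k) $ x" and ?b = "\<lambda>x. O_op L f Zs B c 1 (v k) $ x"
  let ?D = "- (mirror p ` I n)"
  have sol: "max (?a x) (?b x) = 0" if "x \<in> ?D" for x
    using run that Suc by (auto simp: algorithm_run_def Let_def O_op_def)
  have I: "I k = {x \<in> ?D. ?a x \<le> lam * ?b x} \<inter> neg_points p"
    using run Suc by (auto simp: algorithm_run_def Let_def O_op_def)
  have D: "x \<in> ?D" if "x \<in> neg_points p" for x
  proof
    assume "x \<in> mirror p ` I n"
    then obtain y where "y \<in> neg_points p" "x = mirror p y"
      using intervention_region_subset[OF run] by blast
    with that show False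
      by (simp add: neg_points_def position_mirror[OF grid])
  qed
  have "?a x \<le> lam * ?b x \<longleftrightarrow> ?a x \<le> ?b x" if "max (?a x) (?b x) = 0" for x
  proof (cases "?b x = 0")
    case True
    then show ?thesis
      by simp
  next
    case False
    with that have "?a x = 0" "?b x < 0"
      by linarith+
    moreover have "lam * ?b x < 0"
      using lam \<open>?b x < 0\<close> by (rule mult_pos_neg)
    ultimately show ?thesis
      by simp
  qed
  with sol D show ?thesis
    unfolding I by blast
qed

section \<open>Convergence of the strategies\<close>

theorem lemma2p5p2:
  fixes p :: "'g::finite \<Rightarrow> real"
    and L :: "real^'g^'g" and f :: "real^'g"
    and Zs :: "'g \<Rightarrow> real set"
    and B :: "real^'g \<Rightarrow> real^'g^'g" and c g :: "real^'g \<Rightarrow> real^'g"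
    and lam :: real
    and v w d :: "nat \<Rightarrow> real^'g" and I :: "nat \<Rightarrow> 'g set" and vstar :: "real^'g"
  defines "M \<equiv> interv_op Zs B c" and "H \<equiv> gain_op p Zs B c g" and "\<psi> \<equiv> (\<lambda>k. ind_vec (I k))"
    and "\<psi>star \<equiv> ind_vec ({x. (L *v vstar + f) $ x \<le> (interv_op Zs B c vstar - vstar) $ x} \<inter> neg_points p)"
    and "bdI \<equiv> {x. (L *v vstar + f) $ x = (interv_op Zs B c vstar - vstar) $ x} \<inter> neg_points p"
    and "R \<equiv> fixed_region Zs B c vstar \<union> - neg_points p"
  assumes grid: "symmetric_grid p"
    and impulse_sets: "valid_impulse_sets p Zs"
    and c_pos: "\<And>\<delta> x. \<delta> \<in> impulses Zs \<Longrightarrow> 0 < c \<delta> $ x"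
    and decoupled: "row_decoupled p Zs B c g"
    and lam_pos: "0 < lam"
    and A0: "\<And>J \<delta> x. (J, \<delta>) \<in> strategies p Zs \<Longrightarrow> x \<in> J \<Longrightarrow> \<exists>y\<in>- J. has_walk (B \<delta>) x y"
    and A1_L: "SDD (- L) \<and> L0_matrix (- L)"
    and A1_B: "\<And>\<delta>. \<delta> \<in> impulses Zs \<Longrightarrow> WDD (mat 1 - B \<delta>) \<and> L0_matrix (mat 1 - B \<delta>)"
    and A2: "\<And>\<delta> x. \<delta> \<in> impulses Zs \<Longrightarrow> 0 \<le> B \<delta> $ x $ x"
    and run: "algorithm_run p L f Zs B c g lam v w I d"
    and conv: "v \<longlonglongrightarrow> vstar"
  shows
    "((\<forall>x\<in>- bdI. (\<lambda>k. \<psi> k $ x) \<longlonglongrightarrow> \<psi>star $ x) \<and> (\<lambda>k. M (v k)) \<longlonglongrightarrow> M vstar) \<and>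
     (\<forall>\<psi>bar \<delta>bar.
        (\<exists>r. strict_mono r \<and> (\<psi> \<circ> r) \<longlonglongrightarrow> \<psi>bar) \<and> (\<exists>s. strict_mono s \<and> (d \<circ> s) \<longlonglongrightarrow> \<delta>bar) \<longrightarrow>
          \<delta>bar \<in> argmax_impulses Zs B c vstar \<and>
          (\<forall>x\<in>- neg_points p. \<psi>bar $ x = 0) \<and>
          (\<forall>x\<in>neg_points p. is_arg_max (\<lambda>i. O_op L f Zs B c i vstar $ x) (\<lambda>i. i \<in> {0, 1}) (\<psi>bar $ x))) \<and>
     (UIP Zs B c vstar \<longrightarrow>
        (\<forall>x\<in>R. (\<lambda>k. d k $ x) \<longlonglongrightarrow> opt_impulse Zs B c vstar $ x) \<and>
        (\<forall>x\<in>mirror p ` R. (\<lambda>k. H (v k) $ x) \<longlonglongrightarrow> H vstar $ x) \<and>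
        ((\<forall>x. unique_impulse_at Zs B c vstar x) \<longrightarrow>
           d \<longlonglongrightarrow> opt_impulse Zs B c vstar \<and> (\<lambda>k. H (v k)) \<longlonglongrightarrow> H vstar))"
proof -
  define O' where "O' = O_op L f Zs B c"
  define opt where "opt = opt_impulse Zs B c"

  have d: "d k = opt (v k)" for k
    using run by (simp add: algorithm_run_def opt_def)
  have opt_argmax: "opt u \<in> argmax_impulses Zs B c u" for u
    unfolding opt_def using impulse_sets decoupled by (rule opt_impulse_in_argmax)
  then have opt_impulses: "opt u \<in> impulses Zs" for u
    using argmax_impulses_subset by blast
  have d_ev: "\<forall>\<^sub>F k in sequentially. d k \<in> argmax_impulses Zs B c vstar"
    using eventually_argmax_impulses_subset[OF impulse_sets conv, of B c]
    by eventually_elim (use d opt_argmax in auto)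

  have I: "I k = {x. O' 0 (v k) $ x \<le> O' 1 (v k) $ x} \<inter> neg_points p" for k
    unfolding O'_def using grid lam_pos run by (rule intervention_region_eq)
  have \<psi>_neg: "\<psi> k $ x = of_bool (O' 0 (v k) $ x \<le> O' 1 (v k) $ x)" if "x \<in> neg_points p" for k x
    using that by (simp add: \<psi>_def ind_vec_def I indicator_def)
  have \<psi>_nonneg: "\<psi> k $ x = 0" if "x \<notin> neg_points p" for k x
    using that by (simp add: \<psi>_def ind_vec_def I)
  have \<psi>_ev: "\<forall>\<^sub>F k in sequentially. is_arg_max (\<lambda>i. O' i vstar $ x) (\<lambda>i. i \<in> {0, 1}) (\<psi> k $ x)"
    if "x \<in> neg_points p" for x
  proof -
    have "\<forall>\<^sub>F k in sequentially. \<forall>i. is_arg_max (\<lambda>i. O' i (v k) $ x) (\<lambda>i. i \<in> {0, 1}) i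
        \<longrightarrow> is_arg_max (\<lambda>i. O' i vstar $ x) (\<lambda>i. i \<in> {0, 1}) i"
      unfolding O'_def
      by (intro eventually_arg_max_limit tendsto_vec_nth tendsto_O_op[OF impulse_sets conv]) simp
    then show ?thesis
    proof eventually_elim
      case (elim k)
      with of_bool_is_arg_max[of "\<lambda>i. O' i (v k) $ x"] show ?case
        unfolding \<psi>_neg[OF that] by blast
    qed
  qed

  have \<psi>_conv: "(\<lambda>k. \<psi> k $ x) \<longlonglongrightarrow> \<psi>star $ x" if "x \<in> - bdI" for x
  proof (cases "x \<in> neg_points p")
    case True
    with that have neq: "O' 0 vstar $ x \<noteq> O' 1 vstar $ x"
      by (simp add: bdI_def O'_def O_op_def)
    have "\<psi>star $ x = of_bool (O' 0 vstar $ x \<le> O' 1 vstar $ x)"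
      using True by (simp add: \<psi>star_def ind_vec_def indicator_def O'_def O_op_def)
    then have "\<forall>\<^sub>F k in sequentially. \<psi> k $ x = \<psi>star $ x"
      using \<psi>_ev[OF True] is_arg_max_iff_of_bool[of "\<lambda>i. O' i vstar $ x", OF neq] by simp
    then show ?thesis
      by (rule tendsto_eventually)
  next
    case False
    then show ?thesis
      by (simp add: \<psi>_nonneg \<psi>star_def ind_vec_def)
  qed

  have M_conv: "(\<lambda>k. M (v k)) \<longlonglongrightarrow> M vstar"
    unfolding M_def using impulse_sets conv by (rule tendsto_interv_op)

  have \<delta>bar: "\<delta>bar \<in> argmax_impulses Zs B c vstar"
    if "strict_mono s" "(d \<circ> s) \<longlonglongrightarrow> \<delta>bar" for s :: "nat \<Rightarrow> nat" and \<delta>bar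
    using limit_point_satisfies[OF finite_impulses[OF impulse_sets] _ that d_ev] opt_impulses d
    by simp

  have \<psi>bar: "(\<forall>x\<in>- neg_points p. \<psi>bar $ x = 0) \<and>
      (\<forall>x\<in>neg_points p. is_arg_max (\<lambda>i. O' i vstar $ x) (\<lambda>i. i \<in> {0, 1}) (\<psi>bar $ x))"
    if r: "strict_mono r" "(\<psi> \<circ> r) \<longlonglongrightarrow> \<psi>bar" for r :: "nat \<Rightarrow> nat" and \<psi>bar
  proof -
    have "\<forall>\<^sub>F k in sequentially. (\<forall>x\<in>- neg_points p. \<psi> k $ x = 0) \<and>
        (\<forall>x\<in>neg_points p. is_arg_max (\<lambda>i. O' i vstar $ x) (\<lambda>i. i \<in> {0, 1}) (\<psi> k $ x))"
      using \<psi>_nonneg \<psi>_ev by (intro eventually_conj eventually_ball_finite) auto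
    moreover have "\<psi> k \<in> range ind_vec" for k
      by (simp add: \<psi>_def)
    ultimately show ?thesis
      using limit_point_satisfies[where A = "range ind_vec" and y = \<psi>, OF _ _ r] by simp
  qed

  \<comment> \<open>Where the limit problem leaves one impulse only, eventual optimality pins the impulse down.\<close>
  have d_single: "\<forall>\<^sub>F k in sequentially. d k $ x = opt vstar $ x"
    if "unique_impulse_at Zs B c vstar x \<or> Zs x = {0}" for x
    using d_ev by eventually_elim (rule argmax_impulses_agree[OF impulse_sets that _ opt_argmax])
  have H_single: "(\<lambda>k. H (v k) $ x) \<longlonglongrightarrow> H vstar $ x"
    if "unique_impulse_at Zs B c vstar (mirror p x) \<or> Zs (mirror p x) = {0}" for x
  proof -
    have "\<forall>\<^sub>F k in sequentially. gain_op_at p B g (opt vstar) (v k) $ x = H (v k) $ x"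
      using d_single[OF that]
    proof eventually_elim
      case (elim k)
      then show ?case
        using gain_op_at_depends_on_mirror[OF decoupled opt_impulses[of vstar] opt_impulses[of "v k"], of x]
        by (simp add: H_def gain_op_def d flip: opt_def)
    qed
    moreover have "(\<lambda>k. gain_op_at p B g (opt vstar) (v k) $ x) \<longlonglongrightarrow> H vstar $ x"
      unfolding H_def gain_op_def opt_def by (intro tendsto_vec_nth tendsto_gain_op_at conv)
    ultimately show ?thesis
      by (rule Lim_transform_eventually[rotated])
  qed

  have R_single: "unique_impulse_at Zs B c vstar x \<or> Zs x = {0}" if "UIP Zs B c vstar" "x \<in> R" for x
    using that impulse_sets by (auto simp: R_def UIP_def valid_impulse_sets_def neg_points_def)

  have uip: "(\<forall>x\<in>R. (\<lambda>k. d k $ x) \<longlonglongrightarrow> opt vstar $ x) \<and>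
      (\<forall>x\<in>mirror p ` R. (\<lambda>k. H (v k) $ x) \<longlonglongrightarrow> H vstar $ x)"
    if "UIP Zs B c vstar"
    using d_single H_single R_single[OF that] mirror_mirror[OF grid]
    by (auto intro!: tendsto_eventually)
  have unique: "d \<longlonglongrightarrow> opt vstar \<and> (\<lambda>k. H (v k)) \<longlonglongrightarrow> H vstar"
    if "\<forall>x. unique_impulse_at Zs B c vstar x"
  proof
    show "d \<longlonglongrightarrow> opt vstar"
      using that by (intro vec_tendstoI tendsto_eventually d_single) simp
    show "(\<lambda>k. H (v k)) \<longlonglongrightarrow> H vstar"
      using that by (intro vec_tendstoI H_single) simp
  qed
  show ?thesis
    unfolding O'_def[symmetric] opt_def[symmetric]
  proof (intro conjI allI impI)
    fix \<psi>bar \<delta>bar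
    assume limits: "(\<exists>r. strict_mono r \<and> (\<psi> \<circ> r) \<longlonglongrightarrow> \<psi>bar) \<and>
      (\<exists>s. strict_mono s \<and> (d \<circ> s) \<longlonglongrightarrow> \<delta>bar)"
    from limits show "\<delta>bar \<in> argmax_impulses Zs B c vstar"
      using \<delta>bar by (elim conjE exE)
    from limits show "\<forall>x\<in>- neg_points p. \<psi>bar $ x = 0"
      using \<psi>bar by (elim conjE exE) simp
    from limits show
      "\<forall>x\<in>neg_points p. is_arg_max (\<lambda>i. O' i vstar $ x) (\<lambda>i. i \<in> {0, 1}) (\<psi>bar $ x)"
      using \<psi>bar by (elim conjE exE) simp
  qed (use \<psi>_conv M_conv uip unique in simp_all)
qed

end
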